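(* Given a set $S\subseteq[n-1]$ and fixed $0\leq \ell\leq n-2$, the number of prime parking functions $\pi\in\mathrm{PPF}_n$ with $\mathrm{Set}_{\ell}(\pi)=S$ is $$|\{\pi \in \mathrm{PPF}_n : \mathrm{Set}_{\ell}(\pi)=S\}| =(n-2)^{n-1-|S|}.$$
   Context: A parking function of length $n$ is a sequence of positive integers whose increasing rearrangement $\lambda$ satisfies $\lambda_i\le i$; it is prime if removing any instance of 1 yields a parking function of length $n-1$. $\mathrm{PPF}_n$ denotes the set of prime parking functions of length $n$. A tuple $(x_1,\dots,x_n)$ has an $\ell$-forward difference at $i\in[n-1]$ if $x_{i+1}-x_i\equiv\ell\pmod{n-1}$; $\mathrm{Set}_\ell(\pi)$ is the set of indices $i$ at which $\pi$ has an $\ell$-forward difference (so $\mathrm{Set}_0(\pi)$ is the tie set). *)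

theory Defs
  imports "HOL-Number_Theory.Cong"
begin

definition parking_function :: "nat \<Rightarrow> nat list \<Rightarrow> bool" where
  "parking_function n xs \<longleftrightarrow>
     length xs = n \<and> (\<forall>x\<in>set xs. 1 \<le> x) \<and> (\<forall>i<n. sort xs ! i \<le> i + 1)"

definition remove_nth :: "nat \<Rightarrow> 'a list \<Rightarrow> 'a list" where
  "remove_nth i xs = take i xs @ drop (Suc i) xs"

definition prime_parking_function :: "nat \<Rightarrow> nat list \<Rightarrow> bool" where
  "prime_parking_function n xs \<longleftrightarrow>
     parking_function n xs \<and>
     (\<forall>i<n. xs ! i = 1 \<longrightarrow> parking_function (n - 1) (remove_nth i xs))"

definition PPF :: "nat \<Rightarrow> nat list set" where
  "PPF n = {xs. prime_parking_function n xs}"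

text \<open>Indices are counted from 1, so the entries \<open>x\<^sub>i\<close> and \<open>x\<^sub>i\<^sub>+\<^sub>1\<close> of the tuple are
  \<open>xs ! (i - 1)\<close> and \<open>xs ! i\<close>.\<close>

definition forward_difference_at :: "int \<Rightarrow> nat list \<Rightarrow> nat \<Rightarrow> bool" where
  "forward_difference_at l xs i \<longleftrightarrow>
     [int (xs ! i) - int (xs ! (i - 1)) = l] (mod (int (length xs) - 1))"

definition forward_difference_set :: "int \<Rightarrow> nat list \<Rightarrow> nat set" where
  "forward_difference_set l xs = {i \<in> {1..length xs - 1}. forward_difference_at l xs i}"

end

theory Submission
  imports Defs "HOL-Library.FuncSet"
begin

text \<open>
  Put \<open>m = n - 1\<close>. A tuple is a prime parking function iff its entries lie in \<open>{1..m}\<close> and, for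
  each \<open>j \<in> {1..m}\<close>, more than \<open>j\<close> of its \<open>m + 1\<close> entries are at most \<open>j\<close>. Reading the
  entries modulo \<open>m\<close>, let \<open>c t\<close> be the number of entries in residue class \<open>t\<close>: the numbers
  \<open>c t - 1\<close> sum to \<open>1\<close> over a period, so by the cycle lemma exactly one of the \<open>m\<close> translates of
  the tuple is a prime parking function. Prime parking functions therefore correspond bijectively
  to their sequences of differences modulo \<open>m\<close>, which are arbitrary elements of
  \<open>{0..<m} ^ m\<close>; prescribing where the difference is \<open>l\<close> leaves one choice at each index in
  \<open>S\<close> and \<open>m - 1\<close> choices elsewhere.
\<close>

section \<open>Prime parking functions by counting small entries\<close>

text \<open>The entries at most \<open>b\<close> form an initial segment of a sorted list.\<close>

lemma sorted_nth_le_iff: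
  fixes ys :: "nat list"
  assumes "sorted ys" "i < length ys"
  shows "ys ! i \<le> b \<longleftrightarrow> i < length (filter (\<lambda>x. x \<le> b) ys)"
  using assms
proof (induction ys arbitrary: i)
  case (Cons y ys)
  show ?case
  proof (cases "y \<le> b")
    case True
    with Cons show ?thesis by (cases i) auto
  next
    case False
    hence "\<And>x. x \<in> set (y # ys) \<Longrightarrow> \<not> x \<le> b" using Cons.prems by fastforce
    hence "filter (\<lambda>x. x \<le> b) (y # ys) = []" by (simp add: filter_empty_conv)
    moreover have "\<not> (y # ys) ! i \<le> b"
      using \<open>\<And>x. x \<in> set (y # ys) \<Longrightarrow> \<not> x \<le> b\<close> Cons.prems(2) nth_mem by blast
    ultimately show ?thesis by simp
  qed
qed simp

lemma length_filter_sort: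
  "length (filter P (sort xs)) = length (filter P xs)"
  by (metis mset_filter mset_sort size_mset)

lemma parking_function_iff_count:
  "parking_function n xs \<longleftrightarrow> length xs = n \<and> (\<forall>x\<in>set xs. 1 \<le> x) \<and>
     (\<forall>j\<le>n. j \<le> length (filter (\<lambda>x. x \<le> j) xs))"
proof -
  have "(\<forall>i<n. sort xs ! i \<le> i + 1) \<longleftrightarrow> (\<forall>j\<le>n. j \<le> length (filter (\<lambda>x. x \<le> j) xs))"
    if len: "length xs = n"
  proof -
    have eq: "sort xs ! i \<le> i + 1 \<longleftrightarrow> Suc i \<le> length (filter (\<lambda>x. x \<le> Suc i) xs)"
      if "i < n" for i
      using sorted_nth_le_iff[of "sort xs" i "Suc i"] that len
      by (simp add: length_filter_sort Suc_le_eq)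
    show ?thesis
    proof
      assume "\<forall>i<n. sort xs ! i \<le> i + 1"
      with eq show "\<forall>j\<le>n. j \<le> length (filter (\<lambda>x. x \<le> j) xs)"
        by (metis Suc_le_lessD le0 not0_implies_Suc)
    next
      assume "\<forall>j\<le>n. j \<le> length (filter (\<lambda>x. x \<le> j) xs)"
      with eq show "\<forall>i<n. sort xs ! i \<le> i + 1" by (meson Suc_leI)
    qed
  qed
  thus ?thesis unfolding parking_function_def by blast
qed

lemma length_filter_remove_nth:
  assumes "i < length xs"
  shows "length (filter P xs) = length (filter P (remove_nth i xs)) + (if P (xs ! i) then 1 else 0)"
proof -
  have "length (filter P xs) = length (filter P (take i xs @ xs ! i # drop (Suc i) xs))"
    using id_take_nth_drop[OF assms] by simp
  thus ?thesis by (simp add: remove_nth_def)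
qed

text \<open>Removing a 1 lowers every count with \<open>j \<ge> 1\<close> by exactly one, so
  primality turns the weak inequalities of a parking function into strict ones.\<close>

lemma prime_parking_function_iff_count:
  assumes "n \<ge> 2"
  shows "prime_parking_function n xs \<longleftrightarrow> length xs = n \<and> set xs \<subseteq> {1..n - 1} \<and>
           (\<forall>j\<in>{1..n - 1}. j < length (filter (\<lambda>x. x \<le> j) xs))" (is "?L \<longleftrightarrow> ?R")
proof
  assume L: ?L
  hence pf: "length xs = n" "\<forall>x\<in>set xs. 1 \<le> x"
      "\<And>j. j \<le> n \<Longrightarrow> j \<le> length (filter (\<lambda>x. x \<le> j) xs)"
    by (auto simp: prime_parking_function_def parking_function_iff_count)
  \<comment> \<open>The removal condition says something only if some entry is 1; the count at
    \<open>j = 1\<close> supplies one.\<close>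
  have "filter (\<lambda>x. x \<le> 1) xs \<noteq> []" using pf(3)[of 1] assms by auto
  then obtain x where "x \<in> set xs" "x \<le> 1" by (auto simp: filter_empty_conv)
  with pf obtain i where i: "i < n" "xs ! i = 1"
    by (metis in_set_conv_nth le_antisym)
  with L have rem: "\<And>j. j \<le> n - 1 \<Longrightarrow> j \<le> length (filter (\<lambda>x. x \<le> j) (remove_nth i xs))"
    by (auto simp: prime_parking_function_def parking_function_iff_count)
  have gt: "j < length (filter (\<lambda>x. x \<le> j) xs)" if "j \<in> {1..n - 1}" for j
    using rem[of j] length_filter_remove_nth[of i xs "\<lambda>x. x \<le> j"] that i pf(1) by auto
  \<comment> \<open>At \<open>j = n - 1\<close> the strict bound already accounts for all
    \<open>n\<close> entries, which excludes the value \<open>n\<close>.\<close>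
  have "length (filter (\<lambda>x. x \<le> n - 1) xs) \<ge> length xs" using gt[of "n - 1"] assms pf(1) by fastforce
  hence "\<forall>x\<in>set xs. x \<le> n - 1"
    by (meson length_filter_less not_less)
  with pf gt show ?R by auto
next
  assume R: ?R
  have le: "j \<le> length (filter (\<lambda>x. x \<le> j) xs)" if "j \<le> n" for j
  proof (cases "j = n")
    case True
    have "filter (\<lambda>x. x \<le> n) xs = xs" using R by (force simp: filter_id_conv)
    with True R show ?thesis by simp
  next
    case False
    with that have "j \<le> n - 1" by simp
    with R show ?thesis by (cases "j = 0") (auto simp: less_imp_le)
  qed
  have "parking_function (n - 1) (remove_nth i xs)" if i: "i < n" "xs ! i = 1" for i
    unfolding parking_function_iff_count
  proof (intro conjI allI impI)
    show "length (remove_nth i xs) = n - 1" using R i by (simp add: remove_nth_def)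
    show "\<forall>x\<in>set (remove_nth i xs). 1 \<le> x"
      using R by (auto simp: remove_nth_def dest!: in_set_takeD in_set_dropD)
    fix j assume j: "j \<le> n - 1"
    show "j \<le> length (filter (\<lambda>x. x \<le> j) (remove_nth i xs))"
    proof (cases "j = 0")
      case False
      hence "j < length (filter (\<lambda>x. x \<le> j) xs)" using R j by simp
      thus ?thesis using length_filter_remove_nth[of i xs "\<lambda>x. x \<le> j"] i R by (simp split: if_splits)
    qed simp
  qed
  with R le show ?L by (auto simp: prime_parking_function_def parking_function_iff_count)
qed

section \<open>The cycle lemma\<close>

text \<open>The walk \<open>s\<close> rises by 1 per period, so the last minimum within a period
  lies strictly below the next \<open>m\<close> values.\<close>

lemma cycle_lemma:
  fixes s :: "nat \<Rightarrow> int"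
  assumes m: "m > 0" and per: "\<And>j. s (j + m) = s j + 1"
  shows "\<exists>!k. k < m \<and> (\<forall>j\<in>{1..m}. s k < s (k + j))"
proof -
  define M where "M = Min (s ` {..<m})"
  have M: "M \<le> s j" if "j < m" for j using that by (auto simp: M_def)
  have "M \<in> s ` {..<m}" using m unfolding M_def by (intro Min_in) auto
  then obtain k0 where k0: "k0 < m" "s k0 = M" by auto
  define k where "k = Max {k. k < m \<and> s k = M}"
  have fin: "finite {k. k < m \<and> s k = M}" by simp
  have "k \<in> {k. k < m \<and> s k = M}" unfolding k_def using k0 by (intro Max_in[OF fin]) blast
  hence k: "k < m" "s k = M" by auto
  have last: "i \<le> k" if "i < m" "s i = M" for i
    using Max_ge[OF fin] that unfolding k_def by auto
  have good: "s k < s (k + j)" if "j \<in> {1..m}" for j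
  proof (cases "k + j < m")
    case True
    thus ?thesis using last[of "k + j"] M[of "k + j"] k that by fastforce
  next
    case False
    then obtain r where "k + j = r + m" by (metis add.commute le_Suc_ex not_less)
    thus ?thesis using M[of r] per[of r] k that by auto
  qed
  \<comment> \<open>Two such positions would give \<open>s k < s k' < s k + 1\<close>, impossible
    for integers.\<close>
  have no: False if "k < k'" "k' < m" "\<forall>j\<in>{1..m}. s k < s (k + j)" "\<forall>j\<in>{1..m}. s k' < s (k' + j)"
    for k k'
  proof -
    have "k' - k \<in> {1..m}" "k + m - k' \<in> {1..m}" using that(1,2) by auto
    hence "s k < s (k + (k' - k))" "s k' < s (k' + (k + m - k'))" using that(3,4) by blast+
    hence "s k < s k'" "s k' < s (k + m)" using that(1,2) by simp_all
    thus False using per[of k] by simp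
  qed
  show ?thesis using k good no by (metis linorder_neqE_nat)
qed

section \<open>Translates of a residue sequence\<close>

text \<open>Residues have representatives \<open>0..m-1\<close> while entries lie in
  \<open>{1..m}\<close>; \<open>Suc\<close> bridges the two.\<close>

definition translate :: "nat \<Rightarrow> nat \<Rightarrow> (nat \<Rightarrow> int) \<Rightarrow> nat \<Rightarrow> nat list" where
  "translate n m e k = map (\<lambda>i. Suc (nat ((e i - int k) mod int m))) [0..<n]"

lemma mod_eq_add_iff_mod_diff:
  assumes "t < m"
  shows "x mod int m = int (k + t) mod int m \<longleftrightarrow> nat ((x - int k) mod int m) = t"
proof -
  have "x mod int m = int (k + t) mod int m \<longleftrightarrow> (x - int k) mod int m = int t mod int m"
    by (simp add: mod_eq_dvd_iff algebra_simps)
  also have "\<dots> \<longleftrightarrow> (x - int k) mod int m = int t" using assms by simp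
  also have "\<dots> \<longleftrightarrow> nat ((x - int k) mod int m) = t"
    using assms by (metis nat_0_le nat_int of_nat_0_less_iff pos_mod_sign bot_nat_0.not_eq_extremum not_less0)
  finally show ?thesis .
qed

lemma sum_card_residue_classes:
  fixes n :: nat
  assumes "j \<le> m"
  shows "(\<Sum>t<j. card {i. i < n \<and> e i mod int m = int (k + t) mod int m})
           = card {i. i < n \<and> nat ((e i - int k) mod int m) < j}"
  using assms
proof (induction j)
  case (Suc j)
  let ?A = "{i. i < n \<and> nat ((e i - int k) mod int m) < j}"
  let ?B = "{i. i < n \<and> e i mod int m = int (k + j) mod int m}"
  have "{i. i < n \<and> nat ((e i - int k) mod int m) < Suc j} = ?A \<union> ?B"
    using mod_eq_add_iff_mod_diff[of j m _ k] Suc.prems by (auto simp: less_Suc_eq)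
  moreover have "?A \<inter> ?B = {}"
    using mod_eq_add_iff_mod_diff[of j m _ k] Suc.prems by auto
  hence "card (?A \<union> ?B) = card ?A + card ?B" by (intro card_Un_disjoint) simp_all
  ultimately have "card {i. i < n \<and> nat ((e i - int k) mod int m) < Suc j} = card ?A + card ?B"
    by (rule trans[OF arg_cong])
  with Suc show ?case by simp
qed simp

text \<open>Let \<open>s\<close> be the walk with steps \<open>c t - 1\<close>. Then
  \<open>s (k + j) - s k\<close> is the number of entries at most \<open>j\<close> in the translate
  by \<open>k\<close>, minus \<open>j\<close>, so primality is exactly the condition of the cycle
  lemma.\<close>

lemma unique_prime_translate:
  assumes n: "n \<ge> 2" and m: "m = n - 1"
  shows "\<exists>!k. k < m \<and> translate n m e k \<in> PPF n"
proof -
  define c where "c t = card {i. i < n \<and> e i mod int m = int t mod int m}" for t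
  define s where "s j = (\<Sum>t<j. int (c t) - 1)" for j
  have m0: "m > 0" using n m by simp
  have lt: "nat (x mod int m) < m" for x using m0 by (simp add: nat_less_iff)
  have split: "s (k + j) = s k + (\<Sum>t<j. int (c (k + t)) - 1)" for k j
    by (induction j) (simp_all add: s_def)
  have cnt: "(\<Sum>t<j. int (c (k + t)) - 1) =
      int (card {i. i < n \<and> nat ((e i - int k) mod int m) < j}) - int j" if "j \<le> m" for j k
    using sum_card_residue_classes[OF that, of n e k]
    by (simp add: c_def sum_subtractf flip: of_nat_sum)
  \<comment> \<open>A full period counts all \<open>n = m + 1\<close> entries and subtracts
    \<open>m\<close>.\<close>
  have per: "s (j + m) = s j + 1" for j
    unfolding split cnt[OF order.refl] using lt m n by simp
  have "translate n m e k \<in> PPF n \<longleftrightarrow> (\<forall>j\<in>{1..m}. s k < s (k + j))" for k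
  proof -
    have "length (filter (\<lambda>x. x \<le> j) (translate n m e k)) =
        card {i. i < n \<and> nat ((e i - int k) mod int m) < j}" for j
      unfolding length_filter_conv_card
      by (rule arg_cong[where f = card]) (auto simp: translate_def)
    moreover have "set (translate n m e k) \<subseteq> {1..m}"
      using lt by (auto simp: translate_def Suc_le_eq)
    ultimately have "translate n m e k \<in> PPF n \<longleftrightarrow>
        (\<forall>j\<in>{1..m}. j < card {i. i < n \<and> nat ((e i - int k) mod int m) < j})"
      using n by (simp add: PPF_def prime_parking_function_iff_count m translate_def)
    also have "\<dots> \<longleftrightarrow> (\<forall>j\<in>{1..m}. s k < s (k + j))"
      by (intro ball_cong) (simp_all add: split cnt)
    finally show ?thesis .
  qed
  thus ?thesis using cycle_lemma[of m s, OF m0 per] by simp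
qed

section \<open>Difference sequences\<close>

text \<open>Restricting to \<open>{1..m}\<close> makes this an element of an extensional function
  space, so that equality of functions means equality of differences.\<close>

definition differences :: "nat \<Rightarrow> nat list \<Rightarrow> nat \<Rightarrow> int" where
  "differences m xs = (\<lambda>i\<in>{1..m}. (int (xs ! i) - int (xs ! (i - 1))) mod int m)"

text \<open>Differences determine the entries modulo \<open>m\<close> up to the first one: their
  partial sums give the shape, and \<open>k\<close> encodes the first entry.\<close>

lemma differences_eq_iff_translate:
  assumes len: "length xs = Suc m" and range: "set xs \<subseteq> {1..m}"
    and d: "d \<in> {1..m} \<rightarrow>\<^sub>E {0..<int m}"
  shows "differences m xs = d \<longleftrightarrow> (\<exists>k<m. xs = translate (Suc m) m (\<lambda>i. \<Sum>r=1..i. d r) k)"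
    (is "_ \<longleftrightarrow> (\<exists>k<m. xs = translate _ _ ?e k)")
proof
  have nth: "xs ! i \<in> {1..m}" if "i \<le> m" for i
    using range len that by (metis le_imp_less_Suc nth_mem subsetD)
  hence m0: "m > 0" by fastforce
  assume D: "differences m xs = d"
  \<comment> \<open>Forced by index 0: the empty partial sum is 0, so \<open>xs ! 0 - 1\<close> must
    be congruent to \<open>- k\<close>.\<close>
  define k where "k = nat ((1 - int (xs ! 0)) mod int m)"
  have k: "int k = (1 - int (xs ! 0)) mod int m" "k < m"
    using m0 by (simp_all add: k_def nat_less_iff)
  have cong: "[int (xs ! i) - 1 = ?e i - int k] (mod int m)" if "i \<le> m" for i
    using that
  proof (induction i)
    case 0
    have "[- int k = - (1 - int (xs ! 0))] (mod int m)"
      unfolding k(1) by (simp add: cong_def mod_minus_eq)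
    thus ?case by (simp add: cong_sym_eq)
  next
    case (Suc i)
    have "d (Suc i) = (int (xs ! Suc i) - int (xs ! i)) mod int m"
      using Suc.prems by (simp flip: D add: differences_def)
    hence "[int (xs ! Suc i) - int (xs ! i) = d (Suc i)] (mod int m)" by (simp add: cong_def)
    from cong_add[OF Suc.IH this] Suc.prems show ?case by (simp add: algebra_simps)
  qed
  have "xs ! i = Suc (nat ((?e i - int k) mod int m))" if "i \<le> m" for i
  proof -
    have "(int (xs ! i) - 1) mod int m = int (xs ! i) - 1" using nth[OF that] by auto
    with cong[OF that] have "(?e i - int k) mod int m = int (xs ! i) - 1" by (simp add: cong_def)
    thus ?thesis using nth[OF that] by auto
  qed
  hence "xs = translate (Suc m) m ?e k"
    using len by (intro nth_equalityI) (auto simp: translate_def simp del: upt_Suc)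
  with k show "\<exists>k<m. xs = translate (Suc m) m ?e k" by blast
next
  assume "\<exists>k<m. xs = translate (Suc m) m ?e k"
  then obtain k where k: "k < m" "xs = translate (Suc m) m ?e k" by blast
  have "differences m xs i = d i" for i
  proof (cases "i \<in> {1..m}")
    case True
    have x: "int (xs ! j) = 1 + (?e j - int k) mod int m" if "j \<le> m" for j
      using k that by (simp add: translate_def del: upt_Suc)
    have "(int (xs ! i) - int (xs ! (i - 1))) mod int m =
        ((?e i - int k) - (?e (i - 1) - int k)) mod int m"
    proof -
      have "i \<le> m" "i - 1 \<le> m" using True by auto
      thus ?thesis unfolding x[OF \<open>i \<le> m\<close>] x[OF \<open>i - 1 \<le> m\<close>] by (simp add: mod_diff_eq)
    qed
    \<comment> \<open>The shift \<open>k\<close> cancels and the two partial sums differ by their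
      last term.\<close>
    also have "\<dots> = d i mod int m" using True by (cases i) auto
    also have "\<dots> = d i" using PiE_mem[OF d True] by simp
    finally show ?thesis using True by (simp add: differences_def)
  next
    case False
    thus ?thesis using d by (auto simp: differences_def PiE_def extensional_def)
  qed
  thus "differences m xs = d" by blast
qed

lemma bij_betw_differences:
  assumes n: "n \<ge> 2"
  shows "bij_betw (differences (n - 1)) (PPF n) ({1..n - 1} \<rightarrow>\<^sub>E {0..<int (n - 1)})"
proof -
  obtain m where m: "n = Suc m" "m > 0" using n by (cases n) auto
  have PPF: "length xs = Suc m" "set xs \<subseteq> {1..m}" if "xs \<in> PPF n" for xs
    using that n m by (auto simp: PPF_def prime_parking_function_iff_count)
  have maps: "differences m xs \<in> {1..m} \<rightarrow>\<^sub>E {0..<int m}" for xs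
    using m by (auto simp: differences_def)
  \<comment> \<open>The fibre over \<open>d\<close> consists of the prime translates of its partial
    sums, of which there is exactly one.\<close>
  have uniq: "\<exists>!xs. xs \<in> PPF n \<and> differences m xs = d" if d: "d \<in> {1..m} \<rightarrow>\<^sub>E {0..<int m}" for d
  proof -
    let ?T = "translate (Suc m) m (\<lambda>i. \<Sum>r=1..i. d r)"
    obtain k where k: "k < m" "?T k \<in> PPF n" "\<And>k'. k' < m \<Longrightarrow> ?T k' \<in> PPF n \<Longrightarrow> k' = k"
      using unique_prime_translate[OF n, of m "\<lambda>i. \<Sum>r=1..i. d r"] m by auto
    show ?thesis
      using k differences_eq_iff_translate[OF PPF d] by metis
  qed
  have "bij_betw (differences m) (PPF n) ({1..m} \<rightarrow>\<^sub>E {0..<int m})"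
  proof (intro bij_betwI')
    fix xs ys assume "xs \<in> PPF n" "ys \<in> PPF n"
    with uniq[OF maps[of xs]] show "differences m xs = differences m ys \<longleftrightarrow> xs = ys" by metis
  next
    fix d assume "d \<in> {1..m} \<rightarrow>\<^sub>E {0..<int m}"
    from uniq[OF this] show "\<exists>xs\<in>PPF n. d = differences m xs" by blast
  qed (rule maps)
  thus ?thesis using m by simp
qed

theorem theorem6p1:
  fixes n :: nat and l :: int and S :: "nat set"
  assumes "S \<subseteq> {1..n - 1}" and "0 \<le> l" and "l \<le> int n - 2"
  shows "card {xs \<in> PPF n. forward_difference_set l xs = S} = (n - 2) ^ (n - 1 - card S)"
proof -
  have n: "n \<ge> 2" using assms by simp
  define m where "m = n - 1"
  have m: "n = Suc m" "m > 0" using n by (auto simp: m_def)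
  have l: "l \<in> {0..<int m}" using assms m by simp
  have S: "S \<subseteq> {1..m}" using assms by (simp add: m_def)
  \<comment> \<open>The condition on the \<open>l\<close>-difference set constrains each index
    separately, hence becomes membership in a product of the sets \<open>B i\<close>.\<close>
  define B where "B i = (if i \<in> S then {l} else {0..<int m} - {l})" for i
  have bij: "bij_betw (differences m) (PPF n) ({1..m} \<rightarrow>\<^sub>E {0..<int m})"
    using bij_betw_differences[OF n] by (simp add: m_def)
  have fds: "forward_difference_set l xs = S \<longleftrightarrow> differences m xs \<in> Pi\<^sub>E {1..m} B"
    if "xs \<in> PPF n" for xs
  proof -
    have "length xs = Suc m"
      using that n m by (simp add: PPF_def prime_parking_function_iff_count)
    hence "forward_difference_set l xs = {i \<in> {1..m}. differences m xs i = l}"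
      using l by (auto simp: forward_difference_set_def forward_difference_at_def
          differences_def cong_def)
    moreover have "differences m xs \<in> {1..m} \<rightarrow>\<^sub>E {0..<int m}" using bij that bij_betwE by blast
    ultimately show ?thesis
      using S by (auto simp: B_def PiE_iff split: if_splits)
  qed
  have "Pi\<^sub>E {1..m} B \<subseteq> {1..m} \<rightarrow>\<^sub>E {0..<int m}"
    using l by (intro PiE_mono) (auto simp: B_def)
  \<comment> \<open>Surjectivity ensures that the image is the whole product and not just a part of
    it.\<close>
  hence "Pi\<^sub>E {1..m} B \<subseteq> differences m ` PPF n" using bij_betw_imp_surj_on[OF bij] by simp
  hence "differences m ` {xs \<in> PPF n. differences m xs \<in> Pi\<^sub>E {1..m} B} = Pi\<^sub>E {1..m} B"
    by blast
  hence "differences m ` {xs \<in> PPF n. forward_difference_set l xs = S} = Pi\<^sub>E {1..m} B"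
    using fds by (simp cong: conj_cong)
  moreover have "inj_on (differences m) {xs \<in> PPF n. forward_difference_set l xs = S}"
    using bij by (auto simp: bij_betw_def intro: inj_on_subset)
  ultimately have "card {xs \<in> PPF n. forward_difference_set l xs = S} = card (Pi\<^sub>E {1..m} B)"
    by (metis card_image)
  also have "\<dots> = (\<Prod>i\<in>{1..m}. if i \<in> S then 1 else m - 1)"
    using l by (subst card_PiE) (auto simp: B_def card_Diff_singleton intro!: prod.cong)
  also have "\<dots> = (m - 1) ^ card ({1..m} - S)"
    by (simp add: prod.If_cases Diff_eq)
  also have "card ({1..m} - S) = m - card S"
    using S by (simp add: card_Diff_subset finite_subset)
  finally show ?thesis using m by simp
qed

end
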